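(* The optimal cost function $C^*:\mathbb D\to\mathbb R$ is $L^\natural$-convex on $\mathbb D$, i.e. for all $\mathcal X_1,\mathcal X_2\in\mathbb D$ and all $\xi_1,\xi_2\in\mathbb R$, $$C^*(\mathcal X_1-\xi_1)+C^*(\mathcal X_2-\xi_2)\ \ge\ C^*\big(\mathcal X_1\vee\mathcal X_2-(\xi_1\vee\xi_2)\big)+C^*\big(\mathcal X_1\wedge\mathcal X_2-(\xi_1\wedge\xi_2)\big).$$
   Context: Parameters: lead time $\ell>0$, discount rate $\gamma>0$, drift $\mu\in\mathbb R$, standard deviation $\sigma>0$, unit costs $k^\uparrow,k^\downarrow>0$, and $M>0$. $\Omega$ is the set of continuous functions $\omega:[0,\infty)\to\mathbb R$, $W_t(\omega)=\omega(t)$, $\mathscr F=\sigma(W_t,t\ge0)$, $\mathscr F_t=\sigma(W_s,0\le s\le t)$, and $\mathbb P$ is the probability on $(\Omega,\mathscr F)$ under which $W$ is a Brownian motion started at $0$ with drift $\mu$ and variance $\sigma^2$; $\mathbb E$ is its expectation. Holding cost: $h:\mathbb R\to[0,\infty)$ is convex and piecewise $C^2$, $h(0)=0$, and $|h'|\le M$. States: $\mathbb D$ is the set of functions $\mathcal X:[0,\infty)\to\mathbb R$ that are right-continuous with left limits, non-decreasing, and constant on $[\ell,\infty)$. For $a\in\mathbb R$, $\mathcal X+a$ is the function $u\mapsto\mathcal X(u)+a$. The operations $\vee$ and $\wedge$ on $\mathbb D$ are the pointwise maximum and minimum. Policies: a policy is a pair $\pi=(Y^\uparrow,Y^\downarrow)$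 of $(\mathscr F_t)$-adapted non-negative non-decreasing right-continuous processes (cumulative upward and downward adjustments), with $Y^\uparrow(t)=Y^\downarrow(t)=0$ for $t<0$; an adjustment at time $0$ counts as a jump at $0$ in integrals $\int_0^\infty\cdot\,dY$. $\Pi$ is the set of policies with $\mathbb E[\int_0^\infty e^{-\gamma t}(dY^\uparrow(t)+dY^\downarrow(t))]<\infty$. From initial state $\mathcal X\in\mathbb D$ under $\pi$, the state at time $t$ is $$\mathcal X_t(u)=\mathcal X(t+u)+W_t+Y^\uparrow(t+(u\wedge\ell)-\ell)-Y^\downarrow(t),\quad u\ge0.$$ The cost is $C(\mathcal X,\pi)=\mathbb E[\int_0^\infty e^{-\gamma t}h(\mathcal X_t(0))dt+\int_0^\infty e^{-\gamma t}(k^\uparrow dY^\uparrow(t)+k^\downarrow dY^\downarrow(t))]$, and $C^*(\mathcal X)=\inf_{\pi\in\Pi}C(\mathcal X,\pi)$. *)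

theory Defs
  imports "HOL-Probability.Probability"
begin

text \<open>Functions on $[0,\infty)$ that are states or adjustment processes are represented by total
  functions on the reals. States are constrained, and used, only on \<open>{0..}\<close>. Paths form the sample
  space, so they are taken to be extensional to have exactly one representative each.\<close>

definition path_space :: "(real \<Rightarrow> real) set" where
  "path_space = {\<omega> \<in> extensional {0..}. continuous_on {0..} \<omega>}"

text \<open>The $\sigma$-algebra generated by the coordinates $W_t$, $t \in T$. Thus \<open>path_algebra {0..}\<close>
  is $\mathscr F$ and \<open>path_algebra {0..t}\<close> is $\mathscr F_t$ (not augmented by null sets).\<close>

definition path_algebra :: "real set \<Rightarrow> (real \<Rightarrow> real) measure" where
  "path_algebra T =
     sigma path_space {(\<lambda>\<omega>. \<omega> t) -` A \<inter> path_space | t A. t \<in> T \<and> A \<in> sets borel}"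

text \<open>\<open>P\<close> is the law on path space of Brownian motion started at 0 with drift \<open>\<mu>\<close> and variance
  $\sigma^2$; this determines \<open>P\<close> uniquely. The second parameter of
  \<open>normal_density\<close> is the standard deviation.\<close>

definition brownian_law :: "real \<Rightarrow> real \<Rightarrow> (real \<Rightarrow> real) measure \<Rightarrow> bool" where
  "brownian_law \<mu> \<sigma> P \<longleftrightarrow>
     prob_space P \<and> sets P = sets (path_algebra {0..}) \<and>
     (AE \<omega> in P. \<omega> 0 = 0) \<and>
     (\<forall>s t. 0 \<le> s \<and> s < t \<longrightarrow>
        distributed P lborel (\<lambda>\<omega>. \<omega> t - \<omega> s)
          (\<lambda>x. ennreal (normal_density (\<mu> * (t - s)) (\<sigma> * sqrt (t - s)) x))) \<and>
     (\<forall>(n::nat) (\<tau>::nat \<Rightarrow> real). 0 \<le> \<tau> 0 \<and> (\<forall>i<n. \<tau> i < \<tau> (Suc i)) \<longrightarrow>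
        prob_space.indep_vars P (\<lambda>_. borel) (\<lambda>i \<omega>. \<omega> (\<tau> (Suc i)) - \<omega> (\<tau> i)) {..<n})"

text \<open>The break points may be infinitely many but are locally finite, and no one-sided limits of
  derivatives at them are required; this covers all usual conventions.\<close>

definition piecewise_C2 :: "(real \<Rightarrow> real) \<Rightarrow> bool" where
  "piecewise_C2 h \<longleftrightarrow> continuous_on UNIV h \<and>
     (\<exists>S h' h''. (\<forall>r. finite (S \<inter> {-r..r})) \<and>
        (\<forall>x. x \<notin> S \<longrightarrow> (h has_real_derivative h' x) (at x)) \<and>
        (\<forall>x. x \<notin> S \<longrightarrow> (h' has_real_derivative h'' x) (at x)) \<and>
        continuous_on (- S) h'')"

definition states :: "real \<Rightarrow> (real \<Rightarrow> real) set" where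
  "states l = {X. mono_on {0..} X \<and>
     (\<forall>u\<ge>0. continuous (at_right u) X) \<and>
     (\<forall>u>0. \<exists>L. (X \<longlongrightarrow> L) (at_left u)) \<and>
     (\<forall>u\<ge>l. X u = X l)}"

type_synonym process = "real \<Rightarrow> (real \<Rightarrow> real) \<Rightarrow> real"

definition adjustment :: "process \<Rightarrow> bool" where
  "adjustment Y \<longleftrightarrow>
     (\<forall>t\<ge>0. Y t \<in> borel_measurable (path_algebra {0..t})) \<and>
     (\<forall>\<omega>\<in>path_space.
        (\<forall>t. 0 \<le> Y t \<omega>) \<and> (\<forall>t<0. Y t \<omega> = 0) \<and>
        mono (\<lambda>t. Y t \<omega>) \<and> (\<forall>t. continuous (at_right t) (\<lambda>t. Y t \<omega>)))"

text \<open>$\int_0^\infty e^{-\gamma t}\,dF(t)$ as a Lebesgue-Stieltjes integral over the closed half line.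
  If \<open>F\<close> vanishes on the negative reals, \<open>interval_measure F\<close> has an atom of mass \<open>F 0\<close> at 0, so
  an adjustment at time 0 counts.\<close>

definition discounted :: "real \<Rightarrow> (real \<Rightarrow> real) \<Rightarrow> ennreal" where
  "discounted \<gamma> F = (\<integral>\<^sup>+t\<in>{0..}. ennreal (exp (- \<gamma> * t)) \<partial>interval_measure F)"

text \<open>A policy is a pair of the upward and the downward cumulative adjustments, in this order.\<close>

definition policies :: "(real \<Rightarrow> real) measure \<Rightarrow> real \<Rightarrow> (process \<times> process) set" where
  "policies P \<gamma> = {(Yu, Yd). adjustment Yu \<and> adjustment Yd \<and>
     (\<integral>\<^sup>+\<omega>. discounted \<gamma> (\<lambda>t. Yu t \<omega>) + discounted \<gamma> (\<lambda>t. Yd t \<omega>) \<partial>P) < \<infinity>}"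

definition state_at ::
  "real \<Rightarrow> (real \<Rightarrow> real) \<Rightarrow> process \<times> process \<Rightarrow> real \<Rightarrow> (real \<Rightarrow> real) \<Rightarrow> real \<Rightarrow> real" where
  "state_at l X \<pi> t \<omega> u = X (t + u) + \<omega> t + fst \<pi> (t + min u l - l) \<omega> - snd \<pi> t \<omega>"

text \<open>All integrands are nonnegative, so costs are taken in the extended nonnegative reals.\<close>

definition cost ::
  "(real \<Rightarrow> real) measure \<Rightarrow> real \<Rightarrow> real \<Rightarrow> real \<Rightarrow> real \<Rightarrow> (real \<Rightarrow> real) \<Rightarrow>
   (real \<Rightarrow> real) \<Rightarrow> process \<times> process \<Rightarrow> ennreal" where
  "cost P l \<gamma> ku kd h X \<pi> =
     (\<integral>\<^sup>+\<omega>. (\<integral>\<^sup>+t\<in>{0..}. ennreal (exp (- \<gamma> * t) * h (state_at l X \<pi> t \<omega> 0)) \<partial>lborel)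
        + (ennreal ku * discounted \<gamma> (\<lambda>t. fst \<pi> t \<omega>)
           + ennreal kd * discounted \<gamma> (\<lambda>t. snd \<pi> t \<omega>)) \<partial>P)"

definition opt_cost ::
  "(real \<Rightarrow> real) measure \<Rightarrow> real \<Rightarrow> real \<Rightarrow> real \<Rightarrow> real \<Rightarrow> (real \<Rightarrow> real) \<Rightarrow>
   (real \<Rightarrow> real) \<Rightarrow> ennreal" where
  "opt_cost P l \<gamma> ku kd h X = (INF \<pi>\<in>policies P \<gamma>. cost P l \<gamma> ku kd h X \<pi>)"

definition L_natural_convex_on ::
  "(real \<Rightarrow> real) set \<Rightarrow> ((real \<Rightarrow> real) \<Rightarrow> real) \<Rightarrow> bool" where
  "L_natural_convex_on D f \<longleftrightarrow>
     (\<forall>X1\<in>D. \<forall>X2\<in>D. \<forall>\<xi>1 \<xi>2.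
        f (\<lambda>u. X1 u - \<xi>1) + f (\<lambda>u. X2 u - \<xi>2)
          \<ge> f (\<lambda>u. max (X1 u) (X2 u) - max \<xi>1 \<xi>2) + f (\<lambda>u. min (X1 u) (X2 u) - min \<xi>1 \<xi>2))"

end

theory Submission
  imports Defs "HOL-Real_Asymp.Real_Asymp"
begin

text \<open>
  The inequality already holds path by path, for a suitable choice of policies. Fix policies
  $(U_i, D_i)$ for the initial states $X_i - \xi_i$, $i = 1, 2$. Along a path the net inventory is $a_i(t) - b_i(t) + W_t$, where
  $a_i(t) = X_i(t) + U_i(t - l)$ collects everything that raises it and $b_i(t) = \xi_i + D_i(t)$
  everything that lowers it. If two new policies steer the raising and lowering parts
  to $(a_1 \vee a_2, b_1 \vee b_2)$ and $(a_1 \wedge a_2, b_1 \wedge b_2)$, then the holding costs do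
  not increase, because $(a, b) \mapsto h(a - b + w)$ is $L^\natural$-convex for convex $h$
  (\<open>convex_on_difference_L_natural\<close>).

  Such policies exist because $X_i$ is constant from time $l$ on, while $U_i(t - l)$ vanishes before
  time $l$. Hence $a_1 \vee a_2$ is $X_1 \vee X_2$ plus the delayed upward adjustment
  $(X_1(l) + U_1) \vee (X_2(l) + U_2) - X_1(l) \vee X_2(l)$, which is again adapted, non-negative and
  non-decreasing (\<open>join_process\<close>, \<open>state_join\<close>). The downward adjustments are treated the same
  way with $\xi_i$ in place of $X_i(l)$, and the meets likewise. Since maximum plus minimum is the
  sum, the total adjustments of the join and meet policies are $U_1 + U_2$ and $D_1 + D_2$, so the
  linear adjustment costs agree exactly (\<open>adjustment_cost_join_plus_meet\<close>). Taking expectations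
  gives \<open>cost_join_plus_meet\<close>, and infima give \<open>opt_cost_L_natural\<close>.

  Two analytic points remain. Additivity and measurability in the path of the discounted
  Stieltjes integrals follow from
  $\int_{[0,\infty)} e^{-\gamma t} dF(t) = \int_0^\infty \gamma e^{-\gamma s} F(s) ds$
  (\<open>discounted_eq_nn_integral_lborel\<close>); the rest of measurability comes from right-continuity
  (\<open>right_continuous_process_jointly_measurable\<close>). The optimal cost is finite because never
  adjusting has finite cost: $h(x) \le M |x|$, and $E|W_t|$ grows at most linearly in $t$
  (\<open>opt_cost_finite\<close>).
\<close>

section \<open>Convex functions of one real variable\<close>

text \<open>Of two pairs of points with the same midpoint, the more spread out one has the larger sum of
  values, since each inner point is a convex combination of the outer ones with exchanged weights.\<close>

lemma convex_on_sum_le_spread: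
  fixes h :: "real \<Rightarrow> real"
  assumes h: "convex_on UNIV h" and "p \<le> q" "q \<le> s" and sum: "q + r = p + s"
  shows "h q + h r \<le> h p + h s"
proof (cases "p = s")
  case True
  then show ?thesis using assms by simp
next
  case False
  define c where "c = (q - p) / (s - p)"
  have c: "0 \<le> c" "c \<le> 1" using assms False by (auto simp: c_def field_simps)
  have "c * (s - p) = q - p" using False by (simp add: c_def)
  then have q: "q = (1 - c) *\<^sub>R p + c *\<^sub>R s" and r: "r = (1 - (1 - c)) *\<^sub>R p + (1 - c) *\<^sub>R s"
    using sum by (simp_all add: algebra_simps)
  have "h q \<le> (1 - c) * h p + c * h s" unfolding q using convex_onD[OF h] c by simp
  moreover have "h r \<le> (1 - (1 - c)) * h p + (1 - c) * h s"
    unfolding r using convex_onD[OF h, of "1 - c"] c by simp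
  ultimately show ?thesis by (simp add: algebra_simps)
qed

text \<open>If both pairs are ordered the same way, the two sides agree. Otherwise the left-hand
  arguments pair the larger minuend with the larger subtrahend; they have the same sum as the
  right-hand ones and lie between them.\<close>

lemma convex_on_difference_L_natural:
  fixes h :: "real \<Rightarrow> real"
  assumes h: "convex_on UNIV h"
  shows "h (max a1 a2 - max b1 b2 + w) + h (min a1 a2 - min b1 b2 + w)
    \<le> h (a1 - b1 + w) + h (a2 - b2 + w)"
proof (cases "a1 \<le> a2"; cases "b1 \<le> b2")
  assume "a1 \<le> a2" "\<not> b1 \<le> b2"
  then show ?thesis
    using convex_on_sum_le_spread[OF h, of "a1 - b1 + w" "a2 - b1 + w" "a2 - b2 + w" "a1 - b2 + w"]
    by (simp add: max_def min_def)
next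
  assume "\<not> a1 \<le> a2" "b1 \<le> b2"
  then show ?thesis
    using convex_on_sum_le_spread[OF h, of "a2 - b2 + w" "a1 - b2 + w" "a1 - b1 + w" "a2 - b1 + w"]
    by (simp add: max_def min_def)
qed (simp_all add: max_def min_def)

text \<open>At a point of differentiability the tangent lies below \<open>h\<close> at 0, which is the claim. At a break
  point \<open>x\<close> the bound is transferred along the ray from 0 through \<open>x\<close>: convexity and \<open>h 0 = 0\<close> give
  \<open>h x \<le> h (c * x) / c\<close> for \<open>c > 1\<close>, and all but finitely many \<open>c\<close> below 2 avoid the break
  points.\<close>

lemma convex_bounded_slope_linear_growth:
  fixes h :: "real \<Rightarrow> real"
  assumes h: "convex_on UNIV h" and pc: "piecewise_C2 h" and h0: "h 0 = 0"
    and slope: "\<And>x. h differentiable (at x) \<Longrightarrow> \<bar>deriv h x\<bar> \<le> M"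
  shows "h x \<le> M * \<bar>x\<bar>"
proof -
  from pc obtain S h' where S: "\<And>r. finite (S \<inter> {-r..r})"
    and h': "\<And>x. x \<notin> S \<Longrightarrow> (h has_real_derivative h' x) (at x)"
    unfolding piecewise_C2_def by blast
  have tangent: "h y \<le> M * \<bar>y\<bar>" if "y \<notin> S" for y
  proof -
    have d: "(h has_real_derivative h' y) (at y)" using h' that by blast
    then have "\<bar>h' y\<bar> \<le> M"
      using slope[of y] DERIV_imp_deriv[OF d] by (auto simp: real_differentiable_def)
    moreover have "h' y * (0 - y) \<le> h 0 - h y"
      by (rule convex_on_imp_above_tangent[OF h]) (use d in auto)
    moreover have "h' y * y \<le> \<bar>h' y\<bar> * \<bar>y\<bar>" by (metis abs_ge_self abs_mult)
    moreover have "\<bar>h' y\<bar> * \<bar>y\<bar> \<le> M * \<bar>y\<bar>" using calculation by (intro mult_right_mono) auto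
    ultimately show ?thesis using h0 by simp
  qed
  show ?thesis
  proof (cases "x = 0")
    case True then show ?thesis using h0 by simp
  next
    case False
    define r where "r = 2 * \<bar>x\<bar>"
    have "infinite {1<..<2::real}" by simp
    moreover have "finite ((\<lambda>c. c * x) -` (S \<inter> {-r..r}))"
      using False by (intro finite_vimageI S) (auto simp: inj_on_def)
    ultimately have "\<not> {1<..<2} \<subseteq> (\<lambda>c. c * x) -` (S \<inter> {-r..r})" by (blast intro: finite_subset)
    then obtain c where c: "1 < c" "c < 2" "c * x \<notin> S \<inter> {-r..r}"
      unfolding subset_eq by auto
    have "\<bar>c * x\<bar> \<le> r" using c by (simp add: r_def abs_mult mult_right_mono)
    then have "c * x \<notin> S" using c by (auto simp: abs_le_iff)
    from tangent[OF this] have "h (c * x) \<le> c * (M * \<bar>x\<bar>)" using c by (simp add: abs_mult mult_ac)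
    moreover have "h x \<le> (1 - 1/c) * h 0 + (1/c) * h (c * x)"
      using convex_onD[OF h, of "1/c" 0 "c * x"] c by simp
    then have "c * h x \<le> h (c * x)" using c h0 by (simp add: field_simps)
    ultimately have "c * h x \<le> c * (M * \<bar>x\<bar>)" by linarith
    then show ?thesis using c by (auto intro: mult_left_le_imp_le)
  qed
qed

section \<open>Discounted adjustment cost as an ordinary integral\<close>

lemma nn_integral_exponential_tail:
  assumes "\<gamma> > 0"
  shows "(\<integral>\<^sup>+s\<in>{t..}. ennreal (\<gamma> * exp (- \<gamma> * s)) \<partial>lborel) = ennreal (exp (- \<gamma> * t))"
proof -
  have "((\<lambda>s. - exp (- \<gamma> * s)) \<longlongrightarrow> 0) at_top" using \<open>\<gamma> > 0\<close> by real_asymp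
  moreover have "((\<lambda>s. - exp (- \<gamma> * s)) has_real_derivative \<gamma> * exp (- \<gamma> * s)) (at s)" for s
    by (auto intro!: derivative_eq_intros)
  ultimately have "(\<integral>\<^sup>+s\<in>{t..}. ennreal (\<gamma> * exp (- \<gamma> * s)) \<partial>lborel)
      = ennreal (0 - - exp (- \<gamma> * t))"
    using \<open>\<gamma> > 0\<close> by (intro nn_integral_FTC_atLeast) auto
  then show ?thesis by simp
qed

text \<open>The paths of adjustment processes: distribution functions of locally finite measures on
  the closed half line \<open>{0..}\<close>.\<close>

definition cumulative :: "(real \<Rightarrow> real) \<Rightarrow> bool" where
  "cumulative F \<longleftrightarrow> mono F \<and> (\<forall>t. continuous (at_right t) F) \<and> (\<forall>t<0. F t = 0)"

lemma cumulative_nonneg: "cumulative F \<Longrightarrow> 0 \<le> F t"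
  using monoD[of F "min t (-1)" t] by (auto simp: cumulative_def)

lemma cumulative_add: "cumulative F \<Longrightarrow> cumulative G \<Longrightarrow> cumulative (\<lambda>t. F t + G t)"
  by (auto simp: cumulative_def mono_def intro!: add_mono continuous_add)

lemma adjustment_cumulative:
  "adjustment Y \<Longrightarrow> \<omega> \<in> path_space \<Longrightarrow> cumulative (\<lambda>t. Y t \<omega>)"
  by (auto simp: adjustment_def cumulative_def)

lemma adjustmentI:
  assumes "\<And>t. t \<ge> 0 \<Longrightarrow> Y t \<in> borel_measurable (path_algebra {0..t})"
    and "\<And>\<omega>. \<omega> \<in> path_space \<Longrightarrow> cumulative (\<lambda>t. Y t \<omega>)"
  shows "adjustment Y"
  unfolding adjustment_def
proof (intro conjI allI impI ballI)
  fix t \<omega> assume "\<omega> \<in> path_space"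
  from cumulative_nonneg[OF assms(2)[OF this]] show "0 \<le> Y t \<omega>" .
qed (use assms in \<open>auto simp: cumulative_def\<close>)

text \<open>Integration by parts without boundary terms: write $e^{-\gamma t}$ as
  $\int_t^\infty \gamma e^{-\gamma s} ds$ and exchange the integrals, which are of non-negative functions.
  The inner integral becomes the mass of $[0, s]$, that is \<open>F s\<close>, because an atom at 0 is included.
  The right-hand side is visibly additive and measurable in \<open>F\<close>.\<close>

lemma discounted_eq_nn_integral_lborel:
  assumes "\<gamma> > 0" and F: "cumulative F"
  shows "discounted \<gamma> F = (\<integral>\<^sup>+s\<in>{0..}. ennreal (\<gamma> * exp (- \<gamma> * s) * F s) \<partial>lborel)"
proof -
  have mono: "mono F" and rc: "\<And>t. continuous (at_right t) F" and neg: "\<And>t. t < 0 \<Longrightarrow> F t = 0"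
    using F by (auto simp: cumulative_def)
  let ?I = "interval_measure F"
  have mono': "x \<le> y \<Longrightarrow> F x \<le> F y" for x y using mono by (rule monoD)
  interpret I: sigma_finite_measure ?I
    by (rule sigma_finite_interval_measure[OF mono' rc])
  interpret pair_sigma_finite ?I lborel by standard
  have Ioc: "emeasure ?I {a<..b} = (if a \<le> b then F b - F a else 0)" for a b
    by (rule emeasure_interval_measure_Ioc_eq[OF mono' rc])
  \<comment> \<open>The measure is known on half-open intervals only, so the negative axis is exhausted by
    intervals that stay away from 0, on which \<open>F\<close> is constant.\<close>
  have "(\<Union>n::nat. {- real n<..- (1 / real (Suc n))}) \<in> null_sets ?I"
  proof (rule null_sets_UN)
    fix n
    have "F (- (1 / real (Suc n))) = 0" "n \<noteq> 0 \<Longrightarrow> F (- real n) = 0" by (auto intro!: neg)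
    then show "{- real n<..- (1 / real (Suc n))} \<in> null_sets ?I"
      by (cases "n = 0") (auto simp: Ioc null_sets_def)
  qed
  moreover have "{..<0} \<subseteq> (\<Union>n::nat. {- real n<..- (1 / real (Suc n))})"
  proof
    fix x :: real assume "x \<in> {..<0}"
    then have x: "x < 0" by simp
    obtain n1 :: nat where n1: "- x < real n1" using reals_Archimedean2 by blast
    obtain n2 where n2: "1 / real (Suc n2) < - x" using x reals_Archimedean[of "-x"] by (auto simp: field_simps)
    have "1 / real (Suc (max n1 n2)) \<le> 1 / real (Suc n2)" by (intro divide_left_mono) auto
    then have "x \<in> {- real (max n1 n2)<..- (1 / real (Suc (max n1 n2)))}" using n1 n2 by auto
    then show "x \<in> (\<Union>n::nat. {- real n<..- (1 / real (Suc n))})" by blast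
  qed
  ultimately have nonneg: "AE t in ?I. 0 \<le> t"
    by (intro AE_I'[of "\<Union>n::nat. {- real n<..- (1 / real (Suc n))}"]) (auto simp: not_le)
  have mass: "emeasure ?I {0..s} = F s" if "0 \<le> s" for s
  proof -
    \<comment> \<open>-1 could be any negative number: the two sets differ by a null set.\<close>
    have "emeasure ?I {0..s} = emeasure ?I {-1<..s}"
      by (rule emeasure_eq_AE) (use nonneg in \<open>auto elim!: eventually_mono\<close>)
    then show ?thesis using that neg[of "-1"] by (simp add: Ioc)
  qed
  have "discounted \<gamma> F = (\<integral>\<^sup>+t. (\<integral>\<^sup>+s. (if 0 \<le> t \<and> t \<le> s then ennreal (\<gamma> * exp (- \<gamma> * s)) else 0) \<partial>lborel) \<partial>?I)"
    unfolding discounted_def nn_integral_exponential_tail[OF \<open>\<gamma> > 0\<close>, symmetric]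
    by (subst nn_integral_multc[symmetric])
       (auto intro!: nn_integral_cong simp: indicator_def)
  also have "\<dots> = (\<integral>\<^sup>+s. (\<integral>\<^sup>+t. (if 0 \<le> t \<and> t \<le> s then ennreal (\<gamma> * exp (- \<gamma> * s)) else 0) \<partial>?I) \<partial>lborel)"
    by (rule Fubini'[symmetric]) measurable
  also have "\<dots> = (\<integral>\<^sup>+s. ennreal (\<gamma> * exp (- \<gamma> * s)) * emeasure ?I {0..s} \<partial>lborel)"
    by (subst nn_integral_cmult_indicator[symmetric])
       (auto intro!: nn_integral_cong simp: indicator_def)
  also have "\<dots> = (\<integral>\<^sup>+s\<in>{0..}. ennreal (\<gamma> * exp (- \<gamma> * s) * F s) \<partial>lborel)"
    using mass \<open>\<gamma> > 0\<close>
    by (intro nn_integral_cong) (auto simp: indicator_def ennreal_mult' intro!: mult_nonneg_nonneg)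
  finally show ?thesis .
qed

lemma discounted_zero: "\<gamma> > 0 \<Longrightarrow> discounted \<gamma> (\<lambda>_. 0) = 0"
  by (subst discounted_eq_nn_integral_lborel) (auto simp: cumulative_def mono_def)

lemma discounted_add:
  assumes "\<gamma> > 0" and F: "cumulative F" and G: "cumulative G"
  shows "discounted \<gamma> (\<lambda>t. F t + G t) = discounted \<gamma> F + discounted \<gamma> G"
proof -
  have [measurable]: "F \<in> borel_measurable borel" "G \<in> borel_measurable borel"
    using F G by (auto simp: cumulative_def intro: borel_measurable_mono)
  have "ennreal (\<gamma> * exp (- \<gamma> * s) * (F s + G s))
      = ennreal (\<gamma> * exp (- \<gamma> * s) * F s) + ennreal (\<gamma> * exp (- \<gamma> * s) * G s)" for s
    using cumulative_nonneg[OF F] cumulative_nonneg[OF G] \<open>\<gamma> > 0\<close>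
    by (simp add: ring_distribs flip: ennreal_plus)
  then show ?thesis
    unfolding discounted_eq_nn_integral_lborel[OF \<open>\<gamma> > 0\<close> cumulative_add[OF F G]]
      discounted_eq_nn_integral_lborel[OF \<open>\<gamma> > 0\<close> F] discounted_eq_nn_integral_lborel[OF \<open>\<gamma> > 0\<close> G]
    by (subst nn_integral_add[symmetric]) (auto simp: ring_distribs)
qed

section \<open>Measurability in time and path\<close>

text \<open>The process is the pointwise limit of its discretisations to the grid of mesh \<open>1 / (n + 1)\<close>.
  Each of these involves countably many times only. The grid point is taken strictly to the right of
  \<open>t\<close>, so that right-continuity applies.\<close>

lemma right_continuous_process_jointly_measurable:
  fixes Z :: "real \<Rightarrow> 'a \<Rightarrow> real"
  assumes meas: "\<And>t. Z t \<in> borel_measurable N"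
    and rc: "\<And>\<omega> t. \<omega> \<in> space N \<Longrightarrow> continuous (at_right t) (\<lambda>t. Z t \<omega>)"
  shows "(\<lambda>(t, \<omega>). Z t \<omega>) \<in> borel_measurable (borel \<Otimes>\<^sub>M N)"
proof -
  define c where "c n i = (real_of_int i + 1) / real (Suc n)" for n :: nat and i
  have "(\<lambda>x. Z (c n \<lfloor>real (Suc n) * fst x\<rfloor>) (snd x)) \<in> borel_measurable (borel \<Otimes>\<^sub>M N)" for n
    by (rule measurable_compose_countable[where f = "\<lambda>i x. Z (c n i) (snd x)"])
       (use meas in measurable)
  moreover have "(\<lambda>n. Z (c n \<lfloor>real (Suc n) * t\<rfloor>) \<omega>) \<longlonglongrightarrow> Z t \<omega>" if "\<omega> \<in> space N" for t \<omega>
  proof -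
    let ?c = "\<lambda>n. c n \<lfloor>real (Suc n) * t\<rfloor>"
    have gt: "t < ?c n" for n
    proof -
      have "real (Suc n) * t < real_of_int \<lfloor>real (Suc n) * t\<rfloor> + 1" by linarith
      then show ?thesis by (simp add: c_def field_simps)
    qed
    have le: "?c n \<le> t + 1 / real (Suc n)" for n
    proof -
      have "?c n \<le> (real (Suc n) * t + 1) / real (Suc n)"
        unfolding c_def by (intro divide_right_mono) (linarith, simp)
      also have "\<dots> = t + 1 / real (Suc n)" by (simp only: add_divide_distrib) simp
      finally show ?thesis .
    qed
    have "?c \<longlonglongrightarrow> t"
    proof (rule tendsto_sandwich[where f = "\<lambda>_. t" and h = "\<lambda>n. t + 1 / real (Suc n)"])
      show "(\<lambda>n. t + 1 / real (Suc n)) \<longlonglongrightarrow> t" by real_asymp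
      show "\<forall>\<^sub>F n in sequentially. t \<le> ?c n" using less_imp_le[OF gt] by (intro always_eventually allI)
      show "\<forall>\<^sub>F n in sequentially. ?c n \<le> t + 1 / real (Suc n)" using le by (intro always_eventually allI)
    qed (rule tendsto_const)
    moreover have "\<forall>\<^sub>F n in sequentially. ?c n \<in> {t<..} \<and> ?c n \<noteq> t"
      using gt by (intro always_eventually allI conjI) (auto simp: less_imp_neq[symmetric])
    ultimately have "filterlim ?c (at_right t) sequentially"
      unfolding filterlim_at by blast
    moreover have "((\<lambda>t. Z t \<omega>) \<longlongrightarrow> Z t \<omega>) (at_right t)"
      using rc[OF that, of t] by (simp add: continuous_within)
    ultimately show ?thesis by (rule filterlim_compose[rotated])
  qed
  ultimately have "(\<lambda>x. Z (fst x) (snd x)) \<in> borel_measurable (borel \<Otimes>\<^sub>M N)"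
    by (elim borel_measurable_LIMSEQ_real[rotated]) (simp add: space_pair_measure mem_Times_iff)
  then show ?thesis by (simp only: case_prod_beta')
qed

lemma space_path_algebra: "space (path_algebra T) = path_space"
  unfolding path_algebra_def by (rule space_measure_of) auto

lemma sets_path_algebra_mono: "T \<subseteq> T' \<Longrightarrow> sets (path_algebra T) \<subseteq> sets (path_algebra T')"
  unfolding path_algebra_def
  by (subst (1 2) sets_measure_of) (blast intro!: sigma_sets_mono')+

lemma coordinate_measurable_path_algebra:
  assumes "t \<in> T"
  shows "(\<lambda>\<omega>. \<omega> t) \<in> borel_measurable (path_algebra T)"
proof (rule measurableI)
  fix A :: "real set" assume "A \<in> sets borel"
  then show "(\<lambda>\<omega>. \<omega> t) -` A \<inter> space (path_algebra T) \<in> sets (path_algebra T)"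
    unfolding space_path_algebra unfolding path_algebra_def
    using assms by (subst sets_measure_of) (auto intro!: sigma_sets.Basic)
qed simp

lemma adjustment_measurable:
  assumes "adjustment Y" and P: "sets P = sets (path_algebra {0..})"
  shows "Y t \<in> borel_measurable P"
proof (cases "t \<ge> 0")
  case True
  then have "Y t \<in> borel_measurable (path_algebra {0..t})" using assms(1) by (auto simp: adjustment_def)
  moreover have "borel_measurable (path_algebra {0..t}) \<subseteq> borel_measurable P"
    by (rule measurable_mono)
       (use sets_path_algebra_mono[of "{0..t}" "{0..}"] sets_eq_imp_space_eq[OF P] P in
        \<open>auto simp: space_path_algebra\<close>)
  ultimately show ?thesis by blast
next
  case False
  have "Y t \<omega> = 0" if "\<omega> \<in> space P" for \<omega>
    using that False assms(1) sets_eq_imp_space_eq[OF P] by (auto simp: adjustment_def space_path_algebra)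
  then show ?thesis by (simp cong: measurable_cong)
qed

lemma adjustment_jointly_measurable:
  assumes "adjustment Y" and P: "sets P = sets (path_algebra {0..})"
  shows "(\<lambda>(t, \<omega>). Y t \<omega>) \<in> borel_measurable (borel \<Otimes>\<^sub>M P)"
  using assms sets_eq_imp_space_eq[OF P]
  by (intro right_continuous_process_jointly_measurable adjustment_measurable)
     (auto simp: adjustment_def space_path_algebra)

text \<open>Paths and states carry information on \<open>{0..}\<close> only. Clamping the time to \<open>max 0 t\<close> makes them
  continuous, respectively monotone, on the whole line.\<close>

lemma coordinate_jointly_measurable:
  assumes P: "sets P = sets (path_algebra {0..})"
  shows "(\<lambda>(t, \<omega>). \<omega> (max 0 t)) \<in> borel_measurable (borel \<Otimes>\<^sub>M P)"
proof (rule right_continuous_process_jointly_measurable)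
  fix t :: real
  show "(\<lambda>\<omega>. \<omega> (max 0 t)) \<in> borel_measurable P"
    using coordinate_measurable_path_algebra[of "max 0 t" "{0..}"] P
    by (simp cong: measurable_cong_sets)
next
  fix \<omega> :: "real \<Rightarrow> real" and t :: real
  assume "\<omega> \<in> space P"
  then have "continuous_on {0..} \<omega>"
    using sets_eq_imp_space_eq[OF P] by (simp add: space_path_algebra path_space_def)
  then have "continuous_on UNIV (\<lambda>t. \<omega> (max 0 t))"
    by (rule continuous_on_compose2) (auto intro!: continuous_intros)
  then have "isCont (\<lambda>t. \<omega> (max 0 t)) t" by (simp add: continuous_on_eq_continuous_at)
  then show "continuous (at_right t) (\<lambda>t. \<omega> (max 0 t))" by (rule continuous_at_imp_continuous_at_within)
qed

lemma state_nonneg_time_measurable: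
  assumes "X \<in> states l"
  shows "(\<lambda>t. X (max 0 t)) \<in> borel_measurable borel"
  using assms by (intro borel_measurable_mono) (auto simp: states_def mono_def mono_on_def)

definition holding_rate ::
  "real \<Rightarrow> real \<Rightarrow> (real \<Rightarrow> real) \<Rightarrow> (real \<Rightarrow> real) \<Rightarrow> process \<times> process \<Rightarrow> real \<Rightarrow> (real \<Rightarrow> real) \<Rightarrow> ennreal"
where
  "holding_rate l \<gamma> h X \<pi> t \<omega> = ennreal (exp (- \<gamma> * t) * h (state_at l X \<pi> t \<omega> 0)) * indicator {0..} t"

definition adjustment_cost ::
  "real \<Rightarrow> ennreal \<Rightarrow> ennreal \<Rightarrow> process \<times> process \<Rightarrow> (real \<Rightarrow> real) \<Rightarrow> ennreal" where
  "adjustment_cost \<gamma> ku kd \<pi> \<omega> =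
     ku * discounted \<gamma> (\<lambda>t. fst \<pi> t \<omega>) + kd * discounted \<gamma> (\<lambda>t. snd \<pi> t \<omega>)"

definition path_cost ::
  "real \<Rightarrow> real \<Rightarrow> real \<Rightarrow> real \<Rightarrow> (real \<Rightarrow> real) \<Rightarrow> (real \<Rightarrow> real) \<Rightarrow> process \<times> process \<Rightarrow>
   (real \<Rightarrow> real) \<Rightarrow> ennreal"
where
  "path_cost l \<gamma> ku kd h X \<pi> \<omega> = (\<integral>\<^sup>+t. holding_rate l \<gamma> h X \<pi> t \<omega> \<partial>lborel)
     + adjustment_cost \<gamma> (ennreal ku) (ennreal kd) \<pi> \<omega>"

lemma cost_eq_nn_integral_path_cost:
  "cost P l \<gamma> ku kd h X \<pi> = (\<integral>\<^sup>+\<omega>. path_cost l \<gamma> ku kd h X \<pi> \<omega> \<partial>P)"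
  by (simp add: cost_def path_cost_def holding_rate_def adjustment_cost_def)

lemma holding_rate_jointly_measurable:
  fixes h :: "real \<Rightarrow> real"
  assumes "l > 0" and h: "convex_on UNIV h" and X: "X \<in> states l"
    and P: "sets P = sets (path_algebra {0..})"
    and Y: "adjustment (fst \<pi>)" "adjustment (snd \<pi>)"
  shows "(\<lambda>(t, \<omega>). holding_rate l \<gamma> h X \<pi> t \<omega>)
    \<in> borel_measurable (lborel \<Otimes>\<^sub>M P)"
proof -
  have [measurable]: "h \<in> borel_measurable borel"
    using convex_on_continuous[OF _ h] by (intro borel_measurable_continuous_onI) auto
  have [measurable]: "(\<lambda>t. X (max 0 t)) \<in> borel_measurable borel"
    by (rule state_nonneg_time_measurable[OF X])
  have delay: "(\<lambda>x. (fst x - l, snd x)) \<in> (borel \<Otimes>\<^sub>M P) \<rightarrow>\<^sub>M (borel \<Otimes>\<^sub>M P)" by measurable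
  have [measurable]: "(\<lambda>x. fst \<pi> (fst x - l) (snd x)) \<in> borel_measurable (borel \<Otimes>\<^sub>M P)"
    using measurable_compose[OF delay adjustment_jointly_measurable[OF Y(1) P]]
    unfolding prod.case .
  have [measurable]: "(\<lambda>x. snd \<pi> (fst x) (snd x)) \<in> borel_measurable (borel \<Otimes>\<^sub>M P)"
    using adjustment_jointly_measurable[OF Y(2) P] unfolding case_prod_beta' .
  have [measurable]: "(\<lambda>x. snd x (max 0 (fst x))) \<in> borel_measurable (borel \<Otimes>\<^sub>M P)"
    using coordinate_jointly_measurable[OF P] unfolding case_prod_beta' .
  let ?f = "\<lambda>x. ennreal (exp (- \<gamma> * fst x) * h (X (max 0 (fst x)) + snd x (max 0 (fst x))
    + fst \<pi> (fst x - l) (snd x) - snd \<pi> (fst x) (snd x))) * indicator {0..} (fst x)"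
  have "?f \<in> borel_measurable (borel \<Otimes>\<^sub>M P)" by measurable
  moreover have "?f = (\<lambda>(t, \<omega>). ennreal (exp (- \<gamma> * t) * h (state_at l X \<pi> t \<omega> 0)) * indicator {0..} t)"
    using \<open>l > 0\<close> by (auto simp: fun_eq_iff state_at_def indicator_def)
  ultimately have "(\<lambda>(t, \<omega>). ennreal (exp (- \<gamma> * t) * h (state_at l X \<pi> t \<omega> 0)) * indicator {0..} t)
      \<in> borel_measurable (borel \<Otimes>\<^sub>M P)"
    by (rule back_subst)
  then show ?thesis unfolding holding_rate_def by (simp cong: measurable_cong_sets)
qed

lemma discounted_adjustment_measurable:
  assumes "\<gamma> > 0" and Y: "adjustment Y" and P: "sets P = sets (path_algebra {0..})"
  shows "(\<lambda>\<omega>. discounted \<gamma> (\<lambda>t. Y t \<omega>)) \<in> borel_measurable P"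
proof -
  have [measurable]: "(\<lambda>x. Y (snd x) (fst x)) \<in> borel_measurable (P \<Otimes>\<^sub>M borel)"
    using measurable_pair_swap[OF adjustment_jointly_measurable[OF Y P]]
    by (simp add: case_prod_beta')
  have "(\<lambda>x. ennreal (\<gamma> * exp (- \<gamma> * snd x) * Y (snd x) (fst x)) * indicator {0..} (snd x))
      \<in> borel_measurable (P \<Otimes>\<^sub>M borel)"
    by measurable
  then have "(\<lambda>\<omega>. \<integral>\<^sup>+s\<in>{0..}. ennreal (\<gamma> * exp (- \<gamma> * s) * Y s \<omega>) \<partial>lborel) \<in> borel_measurable P"
    by (intro lborel.borel_measurable_nn_integral) (simp add: case_prod_beta' cong: measurable_cong_sets)
  moreover have "discounted \<gamma> (\<lambda>t. Y t \<omega>) = (\<integral>\<^sup>+s\<in>{0..}. ennreal (\<gamma> * exp (- \<gamma> * s) * Y s \<omega>) \<partial>lborel)"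
    if "\<omega> \<in> space P" for \<omega>
    using that sets_eq_imp_space_eq[OF P]
    by (intro discounted_eq_nn_integral_lborel[OF \<open>\<gamma> > 0\<close> adjustment_cumulative[OF Y]])
       (simp add: space_path_algebra)
  ultimately show ?thesis by (subst measurable_cong)
qed

lemma adjustment_cost_measurable:
  assumes "\<gamma> > 0" and Y: "adjustment (fst \<pi>)" "adjustment (snd \<pi>)"
    and P: "sets P = sets (path_algebra {0..})"
  shows "adjustment_cost \<gamma> ku kd \<pi> \<in> borel_measurable P"
proof -
  note [measurable] = discounted_adjustment_measurable[OF \<open>\<gamma> > 0\<close> Y(1) P]
    discounted_adjustment_measurable[OF \<open>\<gamma> > 0\<close> Y(2) P]
  show ?thesis unfolding adjustment_cost_def[abs_def] by measurable
qed

lemma path_cost_measurable: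
  fixes h :: "real \<Rightarrow> real"
  assumes "l > 0" "\<gamma> > 0" and h: "convex_on UNIV h" and X: "X \<in> states l"
    and P: "sets P = sets (path_algebra {0..})"
    and Y: "adjustment (fst \<pi>)" "adjustment (snd \<pi>)"
  shows "path_cost l \<gamma> ku kd h X \<pi> \<in> borel_measurable P"
proof -
  have [measurable]: "(\<lambda>\<omega>. \<integral>\<^sup>+t. holding_rate l \<gamma> h X \<pi> t \<omega> \<partial>lborel) \<in> borel_measurable P"
    using measurable_pair_swap[OF holding_rate_jointly_measurable[OF \<open>l > 0\<close> h X P Y, of \<gamma>]]
    by (intro lborel.borel_measurable_nn_integral) (simp add: case_prod_beta')
  note [measurable] = adjustment_cost_measurable[OF \<open>\<gamma> > 0\<close> Y P]
  show ?thesis unfolding path_cost_def[abs_def] by measurable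
qed

section \<open>Join and meet of two policies\<close>

text \<open>The offsets \<open>a\<close> and \<open>b\<close> are the levels from which the two adjustments start; subtracting the
  combined level makes the new process start at 0 again.\<close>

definition join_process :: "real \<Rightarrow> real \<Rightarrow> process \<Rightarrow> process \<Rightarrow> process" where
  "join_process a b Y Z t \<omega> = max (a + Y t \<omega>) (b + Z t \<omega>) - max a b"

definition meet_process :: "real \<Rightarrow> real \<Rightarrow> process \<Rightarrow> process \<Rightarrow> process" where
  "meet_process a b Y Z t \<omega> = min (a + Y t \<omega>) (b + Z t \<omega>) - min a b"

lemma adjustment_join_process:
  assumes Y: "adjustment Y" and Z: "adjustment Z"
  shows "adjustment (join_process a b Y Z)"
proof (rule adjustmentI)
  fix t :: real assume "t \<ge> 0"
  then have [measurable]: "Y t \<in> borel_measurable (path_algebra {0..t})"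
      "Z t \<in> borel_measurable (path_algebra {0..t})"
    using assms by (auto simp: adjustment_def)
  show "join_process a b Y Z t \<in> borel_measurable (path_algebra {0..t})"
    unfolding join_process_def[abs_def] by measurable
next
  fix \<omega> assume \<omega>: "\<omega> \<in> path_space"
  note c = adjustment_cumulative[OF Y \<omega>] adjustment_cumulative[OF Z \<omega>]
  then have "mono (\<lambda>t. join_process a b Y Z t \<omega>)"
    unfolding join_process_def
    by (intro monoI diff_right_mono max.mono add_left_mono) (auto simp: cumulative_def mono_def)
  then show "cumulative (\<lambda>t. join_process a b Y Z t \<omega>)"
    using c by (auto simp: cumulative_def join_process_def intro!: continuous_intros)
qed

lemma adjustment_meet_process:
  assumes Y: "adjustment Y" and Z: "adjustment Z"
  shows "adjustment (meet_process a b Y Z)"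
proof (rule adjustmentI)
  fix t :: real assume "t \<ge> 0"
  then have [measurable]: "Y t \<in> borel_measurable (path_algebra {0..t})"
      "Z t \<in> borel_measurable (path_algebra {0..t})"
    using assms by (auto simp: adjustment_def)
  show "meet_process a b Y Z t \<in> borel_measurable (path_algebra {0..t})"
    unfolding meet_process_def[abs_def] by measurable
next
  fix \<omega> assume \<omega>: "\<omega> \<in> path_space"
  note c = adjustment_cumulative[OF Y \<omega>] adjustment_cumulative[OF Z \<omega>]
  then have "mono (\<lambda>t. meet_process a b Y Z t \<omega>)"
    unfolding meet_process_def
    by (intro monoI diff_right_mono min.mono add_left_mono) (auto simp: cumulative_def mono_def)
  then show "cumulative (\<lambda>t. meet_process a b Y Z t \<omega>)"
    using c by (auto simp: cumulative_def meet_process_def intro!: continuous_intros)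
qed

lemma discounted_join_plus_meet:
  assumes "\<gamma> > 0" "adjustment Y" "adjustment Z" "\<omega> \<in> path_space"
  shows "discounted \<gamma> (\<lambda>t. join_process a b Y Z t \<omega>) + discounted \<gamma> (\<lambda>t. meet_process a b Y Z t \<omega>)
    = discounted \<gamma> (\<lambda>t. Y t \<omega>) + discounted \<gamma> (\<lambda>t. Z t \<omega>)"
proof -
  have "join_process a b Y Z t \<omega> + meet_process a b Y Z t \<omega> = Y t \<omega> + Z t \<omega>" for t
    by (simp add: join_process_def meet_process_def max_def min_def)
  then show ?thesis
    using assms by (simp add: discounted_add[symmetric] adjustment_cumulative
        adjustment_join_process adjustment_meet_process)
qed

text \<open>Upward adjustments start from the final levels \<open>X1 l\<close> and \<open>X2 l\<close>: an upward adjustment takes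
  effect only after the lead time \<open>l\<close>, when the initial state has become constant. Downward
  adjustments take effect at once and start from the shifts.\<close>

definition join_policy ::
  "real \<Rightarrow> (real \<Rightarrow> real) \<Rightarrow> (real \<Rightarrow> real) \<Rightarrow> real \<Rightarrow> real \<Rightarrow>
   process \<times> process \<Rightarrow> process \<times> process \<Rightarrow> process \<times> process"
where
  "join_policy l X1 X2 \<xi>1 \<xi>2 \<pi>1 \<pi>2 =
     (join_process (X1 l) (X2 l) (fst \<pi>1) (fst \<pi>2), join_process \<xi>1 \<xi>2 (snd \<pi>1) (snd \<pi>2))"

definition meet_policy ::
  "real \<Rightarrow> (real \<Rightarrow> real) \<Rightarrow> (real \<Rightarrow> real) \<Rightarrow> real \<Rightarrow> real \<Rightarrow>
   process \<times> process \<Rightarrow> process \<times> process \<Rightarrow> process \<times> process"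
where
  "meet_policy l X1 X2 \<xi>1 \<xi>2 \<pi>1 \<pi>2 =
     (meet_process (X1 l) (X2 l) (fst \<pi>1) (fst \<pi>2), meet_process \<xi>1 \<xi>2 (snd \<pi>1) (snd \<pi>2))"

lemma adjustment_join_meet_policy:
  assumes "adjustment (fst \<pi>1)" "adjustment (snd \<pi>1)" "adjustment (fst \<pi>2)" "adjustment (snd \<pi>2)"
  shows "adjustment (fst (join_policy l X1 X2 \<xi>1 \<xi>2 \<pi>1 \<pi>2))"
    and "adjustment (snd (join_policy l X1 X2 \<xi>1 \<xi>2 \<pi>1 \<pi>2))"
    and "adjustment (fst (meet_policy l X1 X2 \<xi>1 \<xi>2 \<pi>1 \<pi>2))"
    and "adjustment (snd (meet_policy l X1 X2 \<xi>1 \<xi>2 \<pi>1 \<pi>2))"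
  unfolding join_policy_def meet_policy_def fst_conv snd_conv
  using assms by (simp_all add: adjustment_join_process adjustment_meet_process)

lemma adjustment_cost_join_plus_meet:
  assumes "\<gamma> > 0" "\<omega> \<in> path_space"
    and Y: "adjustment (fst \<pi>1)" "adjustment (snd \<pi>1)" "adjustment (fst \<pi>2)" "adjustment (snd \<pi>2)"
  shows "adjustment_cost \<gamma> ku kd (join_policy l X1 X2 \<xi>1 \<xi>2 \<pi>1 \<pi>2) \<omega>
      + adjustment_cost \<gamma> ku kd (meet_policy l X1 X2 \<xi>1 \<xi>2 \<pi>1 \<pi>2) \<omega>
    = adjustment_cost \<gamma> ku kd \<pi>1 \<omega> + adjustment_cost \<gamma> ku kd \<pi>2 \<omega>"
proof -
  have regroup: "(c * x + d * y) + (c * x' + d * y') = c * (x + x') + d * (y + y')" for c d x y x' y' :: ennreal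
    by (simp add: distrib_left add_ac)
  show ?thesis
    unfolding adjustment_cost_def join_policy_def meet_policy_def fst_conv snd_conv regroup
    using assms by (simp add: discounted_join_plus_meet)
qed

text \<open>With unit weights the adjustment cost is the quantity whose expectation admissible policies keep
  finite, so the exchange identity for adjustment costs also shows that joins and meets are
  admissible.\<close>

lemma policies_iff:
  "\<pi> \<in> policies P \<gamma> \<longleftrightarrow> adjustment (fst \<pi>) \<and> adjustment (snd \<pi>) \<and>
     (\<integral>\<^sup>+\<omega>. adjustment_cost \<gamma> 1 1 \<pi> \<omega> \<partial>P) < \<infinity>"
  by (simp add: policies_def adjustment_cost_def case_prod_beta')

lemma join_meet_policies:
  assumes "\<gamma> > 0" and P: "sets P = sets (path_algebra {0..})"
    and \<pi>: "\<pi>1 \<in> policies P \<gamma>" "\<pi>2 \<in> policies P \<gamma>"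
  shows "join_policy l X1 X2 \<xi>1 \<xi>2 \<pi>1 \<pi>2 \<in> policies P \<gamma>" (is "?J \<in> _")
    and "meet_policy l X1 X2 \<xi>1 \<xi>2 \<pi>1 \<pi>2 \<in> policies P \<gamma>" (is "?K \<in> _")
proof -
  let ?c = "adjustment_cost \<gamma> 1 1"
  have Y: "adjustment (fst \<pi>1)" "adjustment (snd \<pi>1)" "adjustment (fst \<pi>2)" "adjustment (snd \<pi>2)"
    using \<pi> by (auto simp: policies_iff)
  note adj = adjustment_join_meet_policy[OF Y, of l X1 X2 \<xi>1 \<xi>2]
  note [measurable] = adjustment_cost_measurable[OF \<open>\<gamma> > 0\<close> Y(1,2) P]
    adjustment_cost_measurable[OF \<open>\<gamma> > 0\<close> Y(3,4) P]
    adjustment_cost_measurable[OF \<open>\<gamma> > 0\<close> adj(1,2) P]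
    adjustment_cost_measurable[OF \<open>\<gamma> > 0\<close> adj(3,4) P]
  have "(\<integral>\<^sup>+\<omega>. ?c ?J \<omega> \<partial>P) + (\<integral>\<^sup>+\<omega>. ?c ?K \<omega> \<partial>P) = (\<integral>\<^sup>+\<omega>. ?c ?J \<omega> + ?c ?K \<omega> \<partial>P)"
    by (rule nn_integral_add[symmetric]; measurable)
  also have "\<dots> = (\<integral>\<^sup>+\<omega>. ?c \<pi>1 \<omega> + ?c \<pi>2 \<omega> \<partial>P)"
    using sets_eq_imp_space_eq[OF P] \<open>\<gamma> > 0\<close> Y
    by (intro nn_integral_cong adjustment_cost_join_plus_meet) (auto simp: space_path_algebra)
  also have "\<dots> = (\<integral>\<^sup>+\<omega>. ?c \<pi>1 \<omega> \<partial>P) + (\<integral>\<^sup>+\<omega>. ?c \<pi>2 \<omega> \<partial>P)"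
    by (rule nn_integral_add; measurable)
  also have "\<dots> < \<infinity>" using \<pi> by (simp add: policies_iff)
  finally show "?J \<in> policies P \<gamma>" "?K \<in> policies P \<gamma>"
    using adj by (auto simp: policies_iff)
qed

section \<open>The exchange inequality for costs\<close>

lemma states_eq_final: "X \<in> states l \<Longrightarrow> l \<le> u \<Longrightarrow> X u = X l"
  unfolding states_def by blast

text \<open>Maximum, minimum and shifts preserve states for the same reason: they are monotone and
  continuous operations applied pointwise.\<close>

lemma states_pointwise:
  assumes X: "X1 \<in> states l" "X2 \<in> states l"
    and mono: "\<And>a b c d. a \<le> c \<Longrightarrow> b \<le> d \<Longrightarrow> g a b \<le> g c d"
    and lim: "\<And>F :: real filter. \<And>f1 f2 L1 L2. (f1 \<longlongrightarrow> L1) F \<Longrightarrow> (f2 \<longlongrightarrow> L2) F \<Longrightarrow>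
        ((\<lambda>u. g (f1 u) (f2 u)) \<longlongrightarrow> g L1 L2) F"
  shows "(\<lambda>u. g (X1 u) (X2 u)) \<in> states l"
  unfolding states_def mem_Collect_eq
proof (intro conjI allI impI)
  have "mono_on {0..} X1" "mono_on {0..} X2" using X unfolding states_def by blast+
  then show "mono_on {0..} (\<lambda>u. g (X1 u) (X2 u))"
    by (auto intro!: mono_onI mono dest: mono_onD)
next
  fix u :: real assume "u \<ge> 0"
  then have "continuous (at_right u) X1" "continuous (at_right u) X2"
    using X unfolding states_def by blast+
  then show "continuous (at_right u) (\<lambda>u. g (X1 u) (X2 u))"
    unfolding continuous_within by (rule lim)
next
  fix u :: real assume "u > 0"
  then obtain L1 L2 where "(X1 \<longlongrightarrow> L1) (at_left u)" "(X2 \<longlongrightarrow> L2) (at_left u)"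
    using X unfolding states_def by blast
  then show "\<exists>L. ((\<lambda>u. g (X1 u) (X2 u)) \<longlongrightarrow> L) (at_left u)"
    by (blast intro: lim)
next
  fix u assume "u \<ge> l"
  then show "g (X1 u) (X2 u) = g (X1 l) (X2 l)"
    using states_eq_final[OF X(1)] states_eq_final[OF X(2)] by metis
qed

lemma states_shift: "X \<in> states l \<Longrightarrow> (\<lambda>u. X u - \<xi>) \<in> states l"
  by (rule states_pointwise[where ?g = "\<lambda>a _. a - \<xi>"]) (auto intro: tendsto_intros)

lemma states_max: "X1 \<in> states l \<Longrightarrow> X2 \<in> states l \<Longrightarrow> (\<lambda>u. max (X1 u) (X2 u)) \<in> states l"
  by (rule states_pointwise) (auto intro: tendsto_max max.coboundedI1 max.coboundedI2)

lemma states_min: "X1 \<in> states l \<Longrightarrow> X2 \<in> states l \<Longrightarrow> (\<lambda>u. min (X1 u) (X2 u)) \<in> states l"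
  by (rule states_pointwise) (auto intro: tendsto_min min.coboundedI1 min.coboundedI2)

text \<open>Before time \<open>l\<close> no upward adjustment has arrived, and the initial states alone form the maximum.
  From \<open>l\<close> on the initial states are frozen at \<open>X1 l\<close> and \<open>X2 l\<close>, and the subtracted level in
  \<open>join_process\<close> cancels their maximum.\<close>

lemma state_join:
  assumes X: "X1 \<in> states l" "X2 \<in> states l" and "l > 0" "t \<ge> 0" "\<omega> \<in> path_space"
    and Y: "adjustment (fst \<pi>1)" "adjustment (fst \<pi>2)"
  shows "state_at l (\<lambda>u. max (X1 u) (X2 u) - max \<xi>1 \<xi>2) (join_policy l X1 X2 \<xi>1 \<xi>2 \<pi>1 \<pi>2) t \<omega> 0
    = max (X1 t + fst \<pi>1 (t - l) \<omega>) (X2 t + fst \<pi>2 (t - l) \<omega>)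
      - max (\<xi>1 + snd \<pi>1 t \<omega>) (\<xi>2 + snd \<pi>2 t \<omega>) + \<omega> t"
proof (cases "t < l")
  case True
  then show ?thesis
    using assms by (simp add: state_at_def join_policy_def join_process_def adjustment_def)
next
  case False
  then have "X1 t = X1 l" "X2 t = X2 l" by (intro states_eq_final X; simp)+
  then show ?thesis
    using \<open>l > 0\<close> by (simp add: state_at_def join_policy_def join_process_def)
qed

lemma state_meet:
  assumes X: "X1 \<in> states l" "X2 \<in> states l" and "l > 0" "t \<ge> 0" "\<omega> \<in> path_space"
    and Y: "adjustment (fst \<pi>1)" "adjustment (fst \<pi>2)"
  shows "state_at l (\<lambda>u. min (X1 u) (X2 u) - min \<xi>1 \<xi>2) (meet_policy l X1 X2 \<xi>1 \<xi>2 \<pi>1 \<pi>2) t \<omega> 0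
    = min (X1 t + fst \<pi>1 (t - l) \<omega>) (X2 t + fst \<pi>2 (t - l) \<omega>)
      - min (\<xi>1 + snd \<pi>1 t \<omega>) (\<xi>2 + snd \<pi>2 t \<omega>) + \<omega> t"
proof (cases "t < l")
  case True
  then show ?thesis
    using assms by (simp add: state_at_def meet_policy_def meet_process_def adjustment_def)
next
  case False
  then have "X1 t = X1 l" "X2 t = X2 l" by (intro states_eq_final X; simp)+
  then show ?thesis
    using \<open>l > 0\<close> by (simp add: state_at_def meet_policy_def meet_process_def)
qed

lemma holding_rate_join_plus_meet:
  fixes h :: "real \<Rightarrow> real"
  assumes X: "X1 \<in> states l" "X2 \<in> states l" and "l > 0" "\<omega> \<in> path_space"
    and h: "convex_on UNIV h" and nn: "\<And>x. h x \<ge> 0"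
    and Y: "adjustment (fst \<pi>1)" "adjustment (fst \<pi>2)"
  shows "holding_rate l \<gamma> h (\<lambda>u. max (X1 u) (X2 u) - max \<xi>1 \<xi>2) (join_policy l X1 X2 \<xi>1 \<xi>2 \<pi>1 \<pi>2) t \<omega>
      + holding_rate l \<gamma> h (\<lambda>u. min (X1 u) (X2 u) - min \<xi>1 \<xi>2) (meet_policy l X1 X2 \<xi>1 \<xi>2 \<pi>1 \<pi>2) t \<omega>
    \<le> holding_rate l \<gamma> h (\<lambda>u. X1 u - \<xi>1) \<pi>1 t \<omega> + holding_rate l \<gamma> h (\<lambda>u. X2 u - \<xi>2) \<pi>2 t \<omega>"
proof (cases "t \<ge> 0")
  case True
  have state: "state_at l (\<lambda>u. X u - \<xi>) \<pi> t \<omega> 0 = X t + fst \<pi> (t - l) \<omega> - (\<xi> + snd \<pi> t \<omega>) + \<omega> t"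
    for X \<xi> \<pi> using \<open>l > 0\<close> by (simp add: state_at_def)
  have add: "ennreal (exp (- \<gamma> * t) * h x) + ennreal (exp (- \<gamma> * t) * h y)
      = ennreal (exp (- \<gamma> * t) * (h x + h y))" for x y
    using nn by (simp add: ring_distribs)
  show ?thesis
    unfolding holding_rate_def state_join[OF X \<open>l > 0\<close> True \<open>\<omega> \<in> path_space\<close> Y]
      state_meet[OF X \<open>l > 0\<close> True \<open>\<omega> \<in> path_space\<close> Y]
    unfolding state
    using True convex_on_difference_L_natural[OF h]
    by (simp only: indicator_simps atLeast_iff mult_1_right add) (intro ennreal_leI mult_left_mono; simp)
qed (simp add: holding_rate_def)


text \<open>The exchange inequality integrated over time and then over paths.\<close>

lemma cost_join_plus_meet:
  fixes h :: "real \<Rightarrow> real"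
  assumes "l > 0" "\<gamma> > 0" and P: "sets P = sets (path_algebra {0..})"
    and X: "X1 \<in> states l" "X2 \<in> states l"
    and h: "convex_on UNIV h" and nn: "\<And>x. h x \<ge> 0"
    and Y: "adjustment (fst \<pi>1)" "adjustment (snd \<pi>1)" "adjustment (fst \<pi>2)" "adjustment (snd \<pi>2)"
  shows "cost P l \<gamma> ku kd h (\<lambda>u. max (X1 u) (X2 u) - max \<xi>1 \<xi>2) (join_policy l X1 X2 \<xi>1 \<xi>2 \<pi>1 \<pi>2)
      + cost P l \<gamma> ku kd h (\<lambda>u. min (X1 u) (X2 u) - min \<xi>1 \<xi>2) (meet_policy l X1 X2 \<xi>1 \<xi>2 \<pi>1 \<pi>2)
    \<le> cost P l \<gamma> ku kd h (\<lambda>u. X1 u - \<xi>1) \<pi>1 + cost P l \<gamma> ku kd h (\<lambda>u. X2 u - \<xi>2) \<pi>2"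
proof -
  let ?XJ = "\<lambda>u. max (X1 u) (X2 u) - max \<xi>1 \<xi>2" and ?XK = "\<lambda>u. min (X1 u) (X2 u) - min \<xi>1 \<xi>2"
  let ?X1 = "\<lambda>u. X1 u - \<xi>1" and ?X2 = "\<lambda>u. X2 u - \<xi>2"
  let ?J = "join_policy l X1 X2 \<xi>1 \<xi>2 \<pi>1 \<pi>2" and ?K = "meet_policy l X1 X2 \<xi>1 \<xi>2 \<pi>1 \<pi>2"
  let ?c = "path_cost l \<gamma> ku kd h"
  let ?H = "holding_rate l \<gamma> h"
  let ?A = "adjustment_cost \<gamma> (ennreal ku) (ennreal kd)"
  note adj = adjustment_join_meet_policy[OF Y, of l X1 X2 \<xi>1 \<xi>2]
  have st: "?XJ \<in> states l" "?XK \<in> states l" "?X1 \<in> states l" "?X2 \<in> states l"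
    by (rule states_shift[OF states_max[OF X]] states_shift[OF states_min[OF X]]
        states_shift[OF X(1)] states_shift[OF X(2)])+
  have pc: "?c X \<pi> \<omega> = (\<integral>\<^sup>+t. ?H X \<pi> t \<omega> \<partial>lborel) + ?A \<pi> \<omega>" for X \<pi> \<omega>
    by (simp add: path_cost_def)
  have pathwise: "?c ?XJ ?J \<omega> + ?c ?XK ?K \<omega> \<le> ?c ?X1 \<pi>1 \<omega> + ?c ?X2 \<pi>2 \<omega>" if "\<omega> \<in> space P" for \<omega>
  proof -
    have \<omega>: "\<omega> \<in> path_space" using that sets_eq_imp_space_eq[OF P] by (simp add: space_path_algebra)
    have meas: "(\<lambda>t. ?H X \<pi> t \<omega>) \<in> borel_measurable lborel"
      if "X \<in> states l" "adjustment (fst \<pi>)" "adjustment (snd \<pi>)" for X \<pi>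
      using measurable_compose[OF measurable_Pair2'[OF \<open>\<omega> \<in> space P\<close>]
          holding_rate_jointly_measurable[OF \<open>l > 0\<close> h that(1) P that(2,3)]] by simp
    have "(\<integral>\<^sup>+t. ?H ?XJ ?J t \<omega> \<partial>lborel) + (\<integral>\<^sup>+t. ?H ?XK ?K t \<omega> \<partial>lborel)
        = (\<integral>\<^sup>+t. ?H ?XJ ?J t \<omega> + ?H ?XK ?K t \<omega> \<partial>lborel)"
      using st adj by (intro nn_integral_add[symmetric] meas)
    also have "\<dots> \<le> (\<integral>\<^sup>+t. ?H ?X1 \<pi>1 t \<omega> + ?H ?X2 \<pi>2 t \<omega> \<partial>lborel)"
      by (intro nn_integral_mono holding_rate_join_plus_meet X \<open>l > 0\<close> \<omega> h nn Y)
    also have "\<dots> = (\<integral>\<^sup>+t. ?H ?X1 \<pi>1 t \<omega> \<partial>lborel) + (\<integral>\<^sup>+t. ?H ?X2 \<pi>2 t \<omega> \<partial>lborel)"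
      using st Y by (intro nn_integral_add meas)
    finally have "((\<integral>\<^sup>+t. ?H ?XJ ?J t \<omega> \<partial>lborel) + (\<integral>\<^sup>+t. ?H ?XK ?K t \<omega> \<partial>lborel)) + (?A ?J \<omega> + ?A ?K \<omega>)
        \<le> ((\<integral>\<^sup>+t. ?H ?X1 \<pi>1 t \<omega> \<partial>lborel) + (\<integral>\<^sup>+t. ?H ?X2 \<pi>2 t \<omega> \<partial>lborel)) + (?A \<pi>1 \<omega> + ?A \<pi>2 \<omega>)"
      using adjustment_cost_join_plus_meet[OF \<open>\<gamma> > 0\<close> \<omega> Y] by (rule add_mono[OF _ eq_refl])
    then show ?thesis unfolding pc by (simp add: add_ac)
  qed
  note meas = path_cost_measurable[OF \<open>l > 0\<close> \<open>\<gamma> > 0\<close> h _ P]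
  have "(\<integral>\<^sup>+\<omega>. ?c ?XJ ?J \<omega> \<partial>P) + (\<integral>\<^sup>+\<omega>. ?c ?XK ?K \<omega> \<partial>P) = (\<integral>\<^sup>+\<omega>. ?c ?XJ ?J \<omega> + ?c ?XK ?K \<omega> \<partial>P)"
    using st adj by (intro nn_integral_add[symmetric] meas)
  also have "\<dots> \<le> (\<integral>\<^sup>+\<omega>. ?c ?X1 \<pi>1 \<omega> + ?c ?X2 \<pi>2 \<omega> \<partial>P)"
    by (intro nn_integral_mono pathwise)
  also have "\<dots> = (\<integral>\<^sup>+\<omega>. ?c ?X1 \<pi>1 \<omega> \<partial>P) + (\<integral>\<^sup>+\<omega>. ?c ?X2 \<pi>2 \<omega> \<partial>P)"
    using st Y by (intro nn_integral_add meas)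
  finally show ?thesis by (simp add: cost_eq_nn_integral_path_cost)
qed


section \<open>Finiteness of the optimal cost\<close>

text \<open>A crude bound that is linear in \<open>t\<close>: with \<open>m\<close> the mean of the increment \<open>x\<close>,
  \<open>\<bar>x\<bar> \<le> \<bar>m\<bar> + 1 + (x - m)\<^sup>2\<close>, and the variance is \<open>\<sigma>\<^sup>2 * t\<close>.\<close>

lemma brownian_abs_moment:
  assumes P: "brownian_law \<mu> \<sigma> P" and "\<sigma> > 0" "t \<ge> 0"
  shows "(\<integral>\<^sup>+\<omega>. ennreal \<bar>\<omega> t\<bar> \<partial>P) \<le> ennreal (\<bar>\<mu>\<bar> * t + 1 + \<sigma>\<^sup>2 * t)"
proof -
  have zero: "AE \<omega> in P. \<omega> 0 = 0" using P by (simp add: brownian_law_def)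
  show ?thesis
  proof (cases "t = 0")
    case True
    have "(\<integral>\<^sup>+\<omega>. ennreal \<bar>\<omega> 0\<bar> \<partial>P) = (\<integral>\<^sup>+\<omega>. 0 \<partial>P)"
      by (rule nn_integral_cong_AE) (use zero in \<open>auto elim!: eventually_mono\<close>)
    then show ?thesis using True by simp
  next
    case False
    define m where "m = \<mu> * t"
    define s where "s = \<sigma> * sqrt t"
    have "t > 0" using False \<open>t \<ge> 0\<close> by simp
    then have "s > 0" using \<open>\<sigma> > 0\<close> by (simp add: s_def)
    have D: "distributed P lborel (\<lambda>\<omega>. \<omega> t - \<omega> 0) (\<lambda>x. ennreal (normal_density m s x))"
    proof -
      have "\<forall>r t. 0 \<le> r \<and> r < t \<longrightarrow> distributed P lborel (\<lambda>\<omega>. \<omega> t - \<omega> r)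
          (\<lambda>x. ennreal (normal_density (\<mu> * (t - r)) (\<sigma> * sqrt (t - r)) x))"
        using P unfolding brownian_law_def by blast
      from this[rule_format, of 0 t] show ?thesis using \<open>t > 0\<close> by (simp add: m_def s_def)
    qed
    have moment: "has_bochner_integral lborel
        (\<lambda>x. normal_density m s x * (\<bar>m\<bar> + 1 + (x - m)\<^sup>2)) (\<bar>m\<bar> + 1 + s\<^sup>2)"
    proof -
      have "has_bochner_integral lborel (\<lambda>x. normal_density m s x) 1"
        using \<open>s > 0\<close> by (simp add: has_bochner_integral_iff)
      then have "has_bochner_integral lborel (\<lambda>x. (\<bar>m\<bar> + 1) * normal_density m s x) ((\<bar>m\<bar> + 1) * 1)"
        by (rule has_bochner_integral_mult_right)
      moreover have "has_bochner_integral lborel (\<lambda>x. normal_density m s x * (x - m)\<^sup>2) (s\<^sup>2)"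
        using normal_moment_even[OF \<open>s > 0\<close>, of m 1] by simp
      ultimately have "has_bochner_integral lborel
          (\<lambda>x. (\<bar>m\<bar> + 1) * normal_density m s x + normal_density m s x * (x - m)\<^sup>2) ((\<bar>m\<bar> + 1) * 1 + s\<^sup>2)"
        by (rule has_bochner_integral_add)
      then show ?thesis by (simp add: algebra_simps)
    qed
    have "(\<integral>\<^sup>+\<omega>. ennreal \<bar>\<omega> t\<bar> \<partial>P) = (\<integral>\<^sup>+\<omega>. ennreal \<bar>\<omega> t - \<omega> 0\<bar> \<partial>P)"
      by (rule nn_integral_cong_AE) (use zero in \<open>auto elim!: eventually_mono\<close>)
    also have "\<dots> = (\<integral>\<^sup>+x. ennreal (normal_density m s x) * ennreal \<bar>x\<bar> \<partial>lborel)"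
      by (rule distributed_nn_integral[OF D, symmetric]) simp
    also have "\<dots> \<le> (\<integral>\<^sup>+x. ennreal (normal_density m s x * (\<bar>m\<bar> + 1 + (x - m)\<^sup>2)) \<partial>lborel)"
    proof (rule nn_integral_mono)
      fix x :: real
      have "\<bar>x - m\<bar> \<le> 1 + (x - m)\<^sup>2"
        using zero_le_power2[of "\<bar>x - m\<bar> - 1"] by (simp add: power2_diff) (smt (verit) zero_le_power2)
      then have "\<bar>x\<bar> \<le> \<bar>m\<bar> + 1 + (x - m)\<^sup>2" by linarith
      then show "ennreal (normal_density m s x) * ennreal \<bar>x\<bar>
          \<le> ennreal (normal_density m s x * (\<bar>m\<bar> + 1 + (x - m)\<^sup>2))"
        by (simp add: ennreal_mult'[symmetric] normal_density_nonneg ennreal_leI mult_left_mono)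
    qed
    also have "\<dots> = ennreal (\<bar>m\<bar> + 1 + s\<^sup>2)"
      using moment by (subst nn_integral_eq_integral)
        (auto simp: has_bochner_integral_iff normal_density_nonneg intro!: AE_I2 mult_nonneg_nonneg add_nonneg_nonneg)
    also have "\<bar>m\<bar> + 1 + s\<^sup>2 = \<bar>\<mu>\<bar> * t + 1 + \<sigma>\<^sup>2 * t"
      using \<open>t > 0\<close> by (simp add: m_def s_def abs_mult power_mult_distrib)
    finally show ?thesis .
  qed
qed

definition zero_policy :: "process \<times> process" where
  "zero_policy = (\<lambda>_ _. 0, \<lambda>_ _. 0)"

lemma adjustment_zero_policy: "adjustment (fst zero_policy)" "adjustment (snd zero_policy)"
  by (auto simp: zero_policy_def adjustment_def mono_def)

lemma adjustment_cost_zero_policy: "\<gamma> > 0 \<Longrightarrow> adjustment_cost \<gamma> ku kd zero_policy \<omega> = 0"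
  by (simp add: adjustment_cost_def zero_policy_def discounted_zero)

lemma zero_policy_in_policies: "\<gamma> > 0 \<Longrightarrow> zero_policy \<in> policies P \<gamma>"
  by (simp add: policies_iff adjustment_zero_policy adjustment_cost_zero_policy)

text \<open>Half of the discount rate absorbs the linear growth, the other half keeps the bound integrable.\<close>

lemma linear_times_exp_le:
  fixes a b t \<gamma> :: real
  assumes "\<gamma> > 0" "t \<ge> 0" "a \<ge> 0" "b \<ge> 0"
  shows "exp (- \<gamma> * t) * (a + b * t) \<le> (a + b * (2 / \<gamma>)) * exp (- (\<gamma> / 2) * t)"
proof -
  define E where "E = exp (- (\<gamma> / 2) * t)"
  have "E > 0" "E \<le> 1" using assms by (auto simp: E_def)
  have "exp (- \<gamma> * t) = E * E" by (simp add: E_def flip: exp_add)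
  have "\<gamma> / 2 * t \<le> exp (\<gamma> / 2 * t)" using exp_ge_add_one_self[of "\<gamma> / 2 * t"] by linarith
  then have "E * (\<gamma> / 2 * t) \<le> E * exp (\<gamma> / 2 * t)" using \<open>E > 0\<close> by simp
  then have "E * t \<le> 2 / \<gamma>" using \<open>\<gamma> > 0\<close> by (simp add: E_def field_simps flip: exp_add)
  then have "a * E + b * (E * t) \<le> a + b * (2 / \<gamma>)"
    using assms \<open>E \<le> 1\<close> by (intro add_mono mult_left_mono mult_right_le_one_le) (auto simp: E_def)
  then have "(a * E + b * (E * t)) * E \<le> (a + b * (2 / \<gamma>)) * E"
    using \<open>E > 0\<close> by (intro mult_right_mono) auto
  then show ?thesis unfolding \<open>exp (- \<gamma> * t) = E * E\<close> E_def[symmetric] by (simp add: algebra_simps)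
qed

text \<open>Under the zero policy the expected holding rate at time \<open>t\<close> is at most $e^{-\gamma t}$ times a
  linear function \<open>A + B * t\<close>, because a state is bounded by its values at 0 and \<open>l\<close>.\<close>

lemma opt_cost_finite:
  fixes h :: "real \<Rightarrow> real"
  assumes "l > 0" "\<gamma> > 0" "\<sigma> > 0" "M > 0" and P: "brownian_law \<mu> \<sigma> P"
    and h: "convex_on UNIV h" and growth: "\<And>x. h x \<le> M * \<bar>x\<bar>"
    and X: "X \<in> states l"
  shows "opt_cost P l \<gamma> ku kd h X < \<infinity>"
proof -
  let ?H = "holding_rate l \<gamma> h X zero_policy"
  have sets: "sets P = sets (path_algebra {0..})" and "prob_space P"
    using P by (auto simp: brownian_law_def)
  interpret prob_space P by fact
  interpret pair_sigma_finite lborel P by standard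
  have coord [measurable]: "(\<lambda>\<omega>. \<omega> t) \<in> borel_measurable P" if "t \<ge> 0" for t
    using coordinate_measurable_path_algebra[of t "{0..}"] that sets by (simp cong: measurable_cong_sets)
  define A where "A = M * (\<bar>X 0\<bar> + \<bar>X l\<bar> + 1)"
  define B where "B = M * (\<bar>\<mu>\<bar> + \<sigma>\<^sup>2)"
  have "A \<ge> 0" "B \<ge> 0" using \<open>M > 0\<close> by (auto simp: A_def B_def)
  have X_bound: "\<bar>X t\<bar> \<le> \<bar>X 0\<bar> + \<bar>X l\<bar>" if "t \<ge> 0" for t
  proof -
    have mono: "mono_on {0..} X" using X unfolding states_def by blast
    have "X 0 \<le> X t" using mono_onD[OF mono, of 0 t] that by simp
    moreover have "X t \<le> X l"
      using mono_onD[OF mono, of t l] that states_eq_final[OF X, of t] by (cases "t \<le> l") auto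
    ultimately show ?thesis by linarith
  qed
  have rate: "(\<integral>\<^sup>+\<omega>. ?H t \<omega> \<partial>P)
      \<le> ennreal ((A + B * (2 / \<gamma>)) * (2 / \<gamma>)) * (ennreal (\<gamma> / 2 * exp (- (\<gamma> / 2) * t)) * indicator {0..} t)"
    for t
  proof (cases "t \<ge> 0")
    case True
    let ?e = "exp (- \<gamma> * t)"
    have "(\<integral>\<^sup>+\<omega>. ?H t \<omega> \<partial>P)
        \<le> (\<integral>\<^sup>+\<omega>. ennreal (?e * M * (\<bar>X 0\<bar> + \<bar>X l\<bar>)) + ennreal (?e * M) * ennreal \<bar>\<omega> t\<bar> \<partial>P)"
    proof (rule nn_integral_mono)
      fix \<omega>
      have "h (X t + \<omega> t) \<le> M * \<bar>X t + \<omega> t\<bar>" by (rule growth)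
      also have "\<dots> \<le> M * (\<bar>X 0\<bar> + \<bar>X l\<bar> + \<bar>\<omega> t\<bar>)"
        using X_bound[OF True] \<open>M > 0\<close> by (intro mult_left_mono) auto
      finally have "?e * h (X t + \<omega> t) \<le> ?e * (M * (\<bar>X 0\<bar> + \<bar>X l\<bar> + \<bar>\<omega> t\<bar>))"
        by simp
      also have "\<dots> = ?e * M * (\<bar>X 0\<bar> + \<bar>X l\<bar>) + ?e * M * \<bar>\<omega> t\<bar>"
        by (simp add: algebra_simps)
      finally have "ennreal (?e * h (X t + \<omega> t))
          \<le> ennreal (?e * M * (\<bar>X 0\<bar> + \<bar>X l\<bar>) + ?e * M * \<bar>\<omega> t\<bar>)" by (rule ennreal_leI)
      also have "\<dots> = ennreal (?e * M * (\<bar>X 0\<bar> + \<bar>X l\<bar>)) + ennreal (?e * M) * ennreal \<bar>\<omega> t\<bar>"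
        using \<open>M > 0\<close> by (subst ennreal_plus) (auto simp: ennreal_mult')
      finally show "?H t \<omega> \<le> ennreal (?e * M * (\<bar>X 0\<bar> + \<bar>X l\<bar>)) + ennreal (?e * M) * ennreal \<bar>\<omega> t\<bar>"
        using True \<open>l > 0\<close> by (simp add: holding_rate_def state_at_def zero_policy_def)
    qed
    also have "\<dots> = ennreal (?e * M * (\<bar>X 0\<bar> + \<bar>X l\<bar>)) + ennreal (?e * M) * (\<integral>\<^sup>+\<omega>. ennreal \<bar>\<omega> t\<bar> \<partial>P)"
      using coord[OF True] by (subst nn_integral_add) (auto simp: nn_integral_cmult emeasure_space_1)
    also have "\<dots> \<le> ennreal (?e * M * (\<bar>X 0\<bar> + \<bar>X l\<bar>)) + ennreal (?e * M) * ennreal (\<bar>\<mu>\<bar> * t + 1 + \<sigma>\<^sup>2 * t)"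
      by (intro add_left_mono mult_left_mono brownian_abs_moment[OF P \<open>\<sigma> > 0\<close> True]) auto
    also have "\<dots> = ennreal (?e * (A + B * t))"
      using \<open>M > 0\<close> True
      by (simp add: ennreal_mult'[symmetric] ennreal_plus[symmetric] A_def B_def algebra_simps del: ennreal_plus)
    also have "\<dots> \<le> ennreal ((A + B * (2 / \<gamma>)) * exp (- (\<gamma> / 2) * t))"
      by (intro ennreal_leI linear_times_exp_le \<open>\<gamma> > 0\<close> True \<open>A \<ge> 0\<close> \<open>B \<ge> 0\<close>)
    also have "(A + B * (2 / \<gamma>)) * exp (- (\<gamma> / 2) * t)
        = ((A + B * (2 / \<gamma>)) * (2 / \<gamma>)) * (\<gamma> / 2 * exp (- (\<gamma> / 2) * t))"
      using \<open>\<gamma> > 0\<close> by simp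
    also have "ennreal \<dots> = ennreal ((A + B * (2 / \<gamma>)) * (2 / \<gamma>)) * ennreal (\<gamma> / 2 * exp (- (\<gamma> / 2) * t))"
      using \<open>\<gamma> > 0\<close> \<open>A \<ge> 0\<close> \<open>B \<ge> 0\<close> by (intro ennreal_mult) auto
    finally show ?thesis using True by simp
  qed (simp add: holding_rate_def)
  have "opt_cost P l \<gamma> ku kd h X \<le> cost P l \<gamma> ku kd h X zero_policy"
    unfolding opt_cost_def by (rule INF_lower[OF zero_policy_in_policies[OF \<open>\<gamma> > 0\<close>]])
  also have "\<dots> = (\<integral>\<^sup>+\<omega>. (\<integral>\<^sup>+t. ?H t \<omega> \<partial>lborel) \<partial>P)"
    using \<open>\<gamma> > 0\<close>
    by (simp add: cost_eq_nn_integral_path_cost path_cost_def adjustment_cost_zero_policy)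
  also have "\<dots> = (\<integral>\<^sup>+t. (\<integral>\<^sup>+\<omega>. ?H t \<omega> \<partial>P) \<partial>lborel)"
    by (rule Fubini'[OF holding_rate_jointly_measurable[OF \<open>l > 0\<close> h X sets adjustment_zero_policy]])
  also have "\<dots> \<le> (\<integral>\<^sup>+t. ennreal ((A + B * (2 / \<gamma>)) * (2 / \<gamma>))
      * (ennreal (\<gamma> / 2 * exp (- (\<gamma> / 2) * t)) * indicator {0..} t) \<partial>lborel)"
    by (rule nn_integral_mono) (rule rate)
  also have "\<dots> = ennreal ((A + B * (2 / \<gamma>)) * (2 / \<gamma>))
      * (\<integral>\<^sup>+t\<in>{0..}. ennreal (\<gamma> / 2 * exp (- (\<gamma> / 2) * t)) \<partial>lborel)"
    by (rule nn_integral_cmult) simp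
  also have "\<dots> < \<infinity>"
    using nn_integral_exponential_tail[of "\<gamma> / 2" 0] \<open>\<gamma> > 0\<close> by (simp add: ennreal_mult_less_top)
  finally show ?thesis .
qed

section \<open>The optimal cost\<close>

text \<open>Apply \<open>cost_join_plus_meet\<close> to policies that are optimal up to \<open>e / 2\<close>.\<close>

lemma opt_cost_L_natural:
  fixes h :: "real \<Rightarrow> real"
  assumes "l > 0" "\<gamma> > 0" and P: "sets P = sets (path_algebra {0..})"
    and X: "X1 \<in> states l" "X2 \<in> states l"
    and h: "convex_on UNIV h" and nn: "\<And>x. h x \<ge> 0"
    and fin: "opt_cost P l \<gamma> ku kd h (\<lambda>u. X1 u - \<xi>1) < \<infinity>" "opt_cost P l \<gamma> ku kd h (\<lambda>u. X2 u - \<xi>2) < \<infinity>"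
  shows "opt_cost P l \<gamma> ku kd h (\<lambda>u. max (X1 u) (X2 u) - max \<xi>1 \<xi>2)
      + opt_cost P l \<gamma> ku kd h (\<lambda>u. min (X1 u) (X2 u) - min \<xi>1 \<xi>2)
    \<le> opt_cost P l \<gamma> ku kd h (\<lambda>u. X1 u - \<xi>1) + opt_cost P l \<gamma> ku kd h (\<lambda>u. X2 u - \<xi>2)"
    (is "?oJ + ?oK \<le> ?o1 + ?o2")
proof (rule ennreal_le_epsilon)
  fix e :: real assume "0 < e"
  obtain \<pi>1 where \<pi>1: "\<pi>1 \<in> policies P \<gamma>"
      "cost P l \<gamma> ku kd h (\<lambda>u. X1 u - \<xi>1) \<pi>1 < ?o1 + ennreal (e / 2)"
    using INF_approx_ennreal[OF half_gt_zero[OF \<open>0 < e\<close>] opt_cost_def less_imp_neq[OF fin(1)]] by blast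
  obtain \<pi>2 where \<pi>2: "\<pi>2 \<in> policies P \<gamma>"
      "cost P l \<gamma> ku kd h (\<lambda>u. X2 u - \<xi>2) \<pi>2 < ?o2 + ennreal (e / 2)"
    using INF_approx_ennreal[OF half_gt_zero[OF \<open>0 < e\<close>] opt_cost_def less_imp_neq[OF fin(2)]] by blast
  note JK = join_meet_policies[OF \<open>\<gamma> > 0\<close> P \<pi>1(1) \<pi>2(1), of l X1 X2 \<xi>1 \<xi>2]
  have "?oJ + ?oK
      \<le> cost P l \<gamma> ku kd h (\<lambda>u. max (X1 u) (X2 u) - max \<xi>1 \<xi>2) (join_policy l X1 X2 \<xi>1 \<xi>2 \<pi>1 \<pi>2)
        + cost P l \<gamma> ku kd h (\<lambda>u. min (X1 u) (X2 u) - min \<xi>1 \<xi>2) (meet_policy l X1 X2 \<xi>1 \<xi>2 \<pi>1 \<pi>2)"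
    unfolding opt_cost_def by (intro add_mono INF_lower JK)
  also have "\<dots> \<le> cost P l \<gamma> ku kd h (\<lambda>u. X1 u - \<xi>1) \<pi>1 + cost P l \<gamma> ku kd h (\<lambda>u. X2 u - \<xi>2) \<pi>2"
    using \<pi>1(1) \<pi>2(1)
    by (intro cost_join_plus_meet \<open>l > 0\<close> \<open>\<gamma> > 0\<close> P X h nn) (auto simp: policies_iff)
  also have "\<dots> \<le> (?o1 + ennreal (e / 2)) + (?o2 + ennreal (e / 2))"
    using \<pi>1(2) \<pi>2(2) by (intro add_mono) auto
  also have "\<dots> = ?o1 + ?o2 + (ennreal (e / 2) + ennreal (e / 2))" by (simp only: add_ac)
  also have "ennreal (e / 2) + ennreal (e / 2) = ennreal e"
    using \<open>0 < e\<close> by (subst ennreal_plus[symmetric]) auto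
  finally show "?oJ + ?oK \<le> ?o1 + ?o2 + ennreal e" .
qed

theorem theorem4p2:
  fixes l \<gamma> \<mu> \<sigma> ku kd M :: real
    and h :: "real \<Rightarrow> real"
    and P :: "(real \<Rightarrow> real) measure"
  assumes "l > 0" and "\<gamma> > 0" and "\<sigma> > 0" and "ku > 0" and "kd > 0" and "M > 0"
    and "brownian_law \<mu> \<sigma> P"
    and "\<And>x. h x \<ge> 0" and "convex_on UNIV h" and "piecewise_C2 h" and "h 0 = 0"
    and "\<And>x. h differentiable (at x) \<Longrightarrow> \<bar>deriv h x\<bar> \<le> M"
  shows "(\<forall>X\<in>states l. opt_cost P l \<gamma> ku kd h X < \<infinity>) \<and>
         L_natural_convex_on (states l) (\<lambda>X. enn2real (opt_cost P l \<gamma> ku kd h X))"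
proof -
  have sets: "sets P = sets (path_algebra {0..})"
    using assms(7) by (simp add: brownian_law_def)
  have finite: "opt_cost P l \<gamma> ku kd h X < \<infinity>" if "X \<in> states l" for X
    using opt_cost_finite[OF assms(1,2,3,6,7,9) convex_bounded_slope_linear_growth[OF assms(9,10,11,12)] that] .
  have "enn2real (opt_cost P l \<gamma> ku kd h (\<lambda>u. max (X1 u) (X2 u) - max \<xi>1 \<xi>2))
        + enn2real (opt_cost P l \<gamma> ku kd h (\<lambda>u. min (X1 u) (X2 u) - min \<xi>1 \<xi>2))
      \<le> enn2real (opt_cost P l \<gamma> ku kd h (\<lambda>u. X1 u - \<xi>1)) + enn2real (opt_cost P l \<gamma> ku kd h (\<lambda>u. X2 u - \<xi>2))"
    if X: "X1 \<in> states l" "X2 \<in> states l" for X1 X2 \<xi>1 \<xi>2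
  proof -
    note fin = finite[OF states_shift[OF states_max[OF X]], of "max \<xi>1 \<xi>2"]
      finite[OF states_shift[OF states_min[OF X]], of "min \<xi>1 \<xi>2"]
      finite[OF states_shift[OF X(1)], of \<xi>1] finite[OF states_shift[OF X(2)], of \<xi>2]
    have "opt_cost P l \<gamma> ku kd h (\<lambda>u. max (X1 u) (X2 u) - max \<xi>1 \<xi>2)
          + opt_cost P l \<gamma> ku kd h (\<lambda>u. min (X1 u) (X2 u) - min \<xi>1 \<xi>2)
        \<le> opt_cost P l \<gamma> ku kd h (\<lambda>u. X1 u - \<xi>1) + opt_cost P l \<gamma> ku kd h (\<lambda>u. X2 u - \<xi>2)"
      by (rule opt_cost_L_natural[OF assms(1,2) sets X assms(9,8) fin(3,4)])
    then show ?thesis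
      using fin by (subst (1 2) enn2real_plus[symmetric]) (auto intro!: enn2real_mono)
  qed
  then show ?thesis using finite unfolding L_natural_convex_on_def by blast
qed

end
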